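(* If $0<t\leq1$, $s>0$, $s+t>1$, and $z\in\mathbf C^d$, then the function $x\mapsto e^{\langle x,z\rangle}$ on $\mathbf R^d$, regarded as an element of $(\Sigma_t^s)'(\mathbf R^d)$, satisfies $$\mathrm{WF}^{t,s}(e^{\langle\cdot,z\rangle})=(\mathbf R^d\setminus0)\times\{0\}.$$
   Context: Notation: $\mathbf N=\{0,1,2,\dots\}$, $D^\beta=(-i)^{|\beta|}\partial^\beta$, $\langle x,z\rangle=\sum_{j=1}^dx_jz_j$ for $x\in\mathbf R^d$, $z\in\mathbf C^d$, $T^*\mathbf R^d\simeq\mathbf R^{2d}$. For $s,t>0$ with $s+t>1$, the (Beurling type) Gelfand--Shilov space $\Sigma_t^s(\mathbf R^d)$ consists of all $f\in C^\infty(\mathbf R^d)$ such that for every $h>0$ $$\|f\|_{\mathcal S_{t,h}^s}=\sup_{\alpha,\beta\in\mathbf N^d,\,x\in\mathbf R^d}\frac{|x^\alpha D^\beta f(x)|}{h^{|\alpha+\beta|}\alpha!^t\beta!^s}<\infty,$$ with the Fréchet topology given by these seminorms. $(\Sigma_t^s)'(\mathbf R^d)$ is its topological dual; the action $(u,\varphi)$ is conjugate linear in $\varphi$ and consistent with the $L^2$ inner product. When $t\leq1$, $e^{\langle\cdot,z\rangle}$ defines an element of $(\Sigma_t^s)'(\mathbf R^d)$ via $\varphi\mapsto\int e^{\langle x,z\rangle}\overline{\varphi(x)}\,dx$. Short-time Fourier transform: with $T_xf(y)=f(y-x)$, $M_\xi f(y)=e^{i\langle y,\xi\rangle}f(y)$,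 set $V_\psi u(x,\xi)=(2\pi)^{-d/2}(u,M_\xi T_x\psi)$. Wave front set: for $u\in(\Sigma_t^s)'(\mathbf R^d)$ and a fixed $\psi\in\Sigma_t^s(\mathbf R^d)\setminus\{0\}$, $(x_0,\xi_0)\in T^*\mathbf R^d\setminus0$ satisfies $(x_0,\xi_0)\notin\mathrm{WF}^{t,s}(u)$ if there is an open set $U\subseteq T^*\mathbf R^d\setminus0$ containing $(x_0,\xi_0)$ such that $$\sup_{\lambda>0,\,(x,\xi)\in U}e^{r\lambda}|V_\psi u(\lambda^tx,\lambda^s\xi)|<\infty\quad\forall r>0.$$ The definition does not depend on the choice of $\psi$. *)

theory Defs
  imports "HOL-Analysis.Analysis"
begin

section \<open>Multi-indices and partial derivatives\<close>

text \<open>Points of \<open>\<real>\<^sup>d\<close> have type \<open>real ^ 'n\<close> with \<open>d = CARD('n)\<close>;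
  multi-indices are functions \<open>'n \<Rightarrow> nat\<close>.\<close>

definition mi_abs :: "('n::finite \<Rightarrow> nat) \<Rightarrow> nat"
  where "mi_abs \<alpha> = (\<Sum>i\<in>UNIV. \<alpha> i)"

definition mi_fact :: "('n::finite \<Rightarrow> nat) \<Rightarrow> real"
  where "mi_fact \<alpha> = (\<Prod>i\<in>UNIV. fact (\<alpha> i))"

definition mi_power :: "real ^ 'n \<Rightarrow> ('n::finite \<Rightarrow> nat) \<Rightarrow> real"
  where "mi_power x \<alpha> = (\<Prod>i\<in>UNIV. (x $ i) ^ \<alpha> i)"

definition partial_deriv ::
    "'n::finite \<Rightarrow> (real ^ 'n \<Rightarrow> complex) \<Rightarrow> real ^ 'n \<Rightarrow> complex"
  where "partial_deriv i f x = vector_derivative (\<lambda>h. f (x + h *\<^sub>R axis i 1)) (at 0)"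

text \<open>\<open>C\<^sup>\<infinity>\<close>: every iterated partial derivative, in any order, is (totally) differentiable.
  Every iterated partial derivative then exists and is continuous, and the converse holds because
  continuously partially differentiable functions are differentiable.\<close>

definition smooth :: "(real ^ 'n::finite \<Rightarrow> complex) \<Rightarrow> bool"
  where "smooth f \<longleftrightarrow> (\<forall>is. foldr partial_deriv is f differentiable_on UNIV)"

text \<open>Since \<open>'n\<close> carries no order, some enumeration of the coordinates is fixed to form
  \<open>\<partial>\<^sup>\<beta>\<close>; for smooth functions the result does not depend on it.\<close>

definition coords :: "'n::finite list"
  where "coords = (SOME is. distinct is \<and> set is = UNIV)"

definition mi_deriv ::
    "('n::finite \<Rightarrow> nat) \<Rightarrow> (real ^ 'n \<Rightarrow> complex) \<Rightarrow> real ^ 'n \<Rightarrow> complex"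
  where "mi_deriv \<beta> f = foldr (\<lambda>i. partial_deriv i ^^ \<beta> i) coords f"

definition mi_D ::
    "('n::finite \<Rightarrow> nat) \<Rightarrow> (real ^ 'n \<Rightarrow> complex) \<Rightarrow> real ^ 'n \<Rightarrow> complex"
  where "mi_D \<beta> f x = (- \<i>) ^ mi_abs \<beta> * mi_deriv \<beta> f x"

section \<open>Gelfand--Shilov spaces of Beurling type and their duals\<close>

definition gs_norm :: "real \<Rightarrow> real \<Rightarrow> real \<Rightarrow> (real ^ 'n::finite \<Rightarrow> complex) \<Rightarrow> ennreal"
  where "gs_norm t s h f =
    (SUP (\<alpha>, \<beta>, x) \<in> UNIV.
      ennreal (cmod (complex_of_real (mi_power x \<alpha>) * mi_D \<beta> f x) /
        (h ^ mi_abs (\<lambda>i. \<alpha> i + \<beta> i) * mi_fact \<alpha> powr t * mi_fact \<beta> powr s)))"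

definition gelfand_shilov :: "real \<Rightarrow> real \<Rightarrow> (real ^ 'n::finite \<Rightarrow> complex) set"
  where "gelfand_shilov t s = {f. smooth f \<and> (\<forall>h>0. gs_norm t s h f < \<infinity>)}"

definition gs_topology :: "real \<Rightarrow> real \<Rightarrow> (real ^ 'n::finite \<Rightarrow> complex) topology"
  where "gs_topology t s = topology_generated_by
    {{g \<in> gelfand_shilov t s. gs_norm t s h (\<lambda>x. g x - f x) < ennreal \<epsilon>} | f h \<epsilon>.
      f \<in> gelfand_shilov t s \<and> h > 0 \<and> \<epsilon> > 0}"

text \<open>Elements of the dual are total functions on \<open>real ^ 'n \<Rightarrow> complex\<close>; only their values on
  the Gelfand--Shilov space matter. They are conjugate linear, so that \<open>u \<phi>\<close> is \<open>(u, \<phi>)\<close>.\<close>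

definition gs_dual :: "real \<Rightarrow> real \<Rightarrow> ((real ^ 'n::finite \<Rightarrow> complex) \<Rightarrow> complex) set"
  where "gs_dual t s = {u.
    (\<forall>\<phi>\<in>gelfand_shilov t s. \<forall>\<eta>\<in>gelfand_shilov t s. u (\<lambda>x. \<phi> x + \<eta> x) = u \<phi> + u \<eta>) \<and>
    (\<forall>\<phi>\<in>gelfand_shilov t s. \<forall>c. u (\<lambda>x. c * \<phi> x) = cnj c * u \<phi>) \<and>
    continuous_map (gs_topology t s) euclidean u}"

definition dist_of_fun ::
    "(real ^ 'n::finite \<Rightarrow> complex) \<Rightarrow> (real ^ 'n \<Rightarrow> complex) \<Rightarrow> complex"
  where "dist_of_fun f \<phi> = (LINT x|lborel. f x * cnj (\<phi> x))"

section \<open>Short-time Fourier transform and the anisotropic wave front set\<close>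

definition translation ::
    "real ^ 'n \<Rightarrow> (real ^ 'n::finite \<Rightarrow> complex) \<Rightarrow> real ^ 'n \<Rightarrow> complex"
  where "translation x f y = f (y - x)"

definition modulation ::
    "real ^ 'n \<Rightarrow> (real ^ 'n::finite \<Rightarrow> complex) \<Rightarrow> real ^ 'n \<Rightarrow> complex"
  where "modulation \<xi> f y = exp (\<i> * complex_of_real (y \<bullet> \<xi>)) * f y"

definition stft ::
    "(real ^ 'n::finite \<Rightarrow> complex) \<Rightarrow> ((real ^ 'n \<Rightarrow> complex) \<Rightarrow> complex) \<Rightarrow>
      real ^ 'n \<Rightarrow> real ^ 'n \<Rightarrow> complex"
  where "stft \<psi> u x \<xi> =
    complex_of_real ((2 * pi) powr (- real CARD('n) / 2)) * u (modulation \<xi> (translation x \<psi>))"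

text \<open>\<open>T\<^sup>*\<real>\<^sup>d \ 0\<close> is \<open>\<real>\<^sup>2\<^sup>d\<close> without the origin (not without the zero section).\<close>

definition wave_front ::
    "real \<Rightarrow> real \<Rightarrow> (real ^ 'n::finite \<Rightarrow> complex) \<Rightarrow>
      ((real ^ 'n \<Rightarrow> complex) \<Rightarrow> complex) \<Rightarrow> ((real ^ 'n) \<times> (real ^ 'n)) set"
  where "wave_front t s \<psi> u = {p. p \<noteq> 0 \<and>
    \<not> (\<exists>U. open U \<and> U \<subseteq> - {0} \<and> p \<in> U \<and>
      (\<forall>r>0. (SUP (l, x, \<xi>) \<in> {0<..} \<times> U.
        ennreal (exp (r * l) * cmod (stft \<psi> u ((l powr t) *\<^sub>R x) ((l powr s) *\<^sub>R \<xi>)))) < \<infinity>))}"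

definition bilin :: "real ^ 'n::finite \<Rightarrow> complex ^ 'n \<Rightarrow> complex"
  where "bilin x z = (\<Sum>j\<in>UNIV. complex_of_real (x $ j) * z $ j)"

end

theory Submission
  imports Defs
begin

text \<open>Write \<open>L w = \<integral> exp \<langle>y, w\<rangle> cnj (\<psi> y) dy\<close>. A translation of the integration variable gives
  \<open>\<bar>V\<^sub>\<psi> exp \<langle>\<cdot>, z\<rangle> (x, \<xi>)\<bar> = c exp \<langle>x, Re z\<rangle> \<bar>L (z - i\<xi>)\<bar>\<close>.
  Since \<open>t \<le> 1\<close>, \<open>\<psi>\<close> and its derivatives decay faster than every exponential, and \<open>n\<close>-fold partial
  integration bounds \<open>\<bar>w\<^sub>j\<bar>\<^sup>n \<bar>L w\<bar>\<close> by \<open>C h\<^sup>n n!\<^sup>s\<close> for every \<open>h\<close>, so that \<open>L (z - i\<xi>)\<close> decays like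
  \<open>exp (- q \<bar>\<xi>\<^sub>j\<bar>\<^bsup>1/s\<^esup>)\<close> for every \<open>q\<close>. Near a point with \<open>\<xi>\<^sub>j \<noteq> 0\<close> this beats the factor
  \<open>exp (\<lambda>\<^sup>t \<langle>x, Re z\<rangle>) = exp (O (1 + \<lambda>))\<close>. Conversely \<open>L (z - i\<eta>) \<noteq> 0\<close> for some \<open>\<eta>\<close>, because the Fourier transform is injective;
  the points \<open>(x, \<lambda>\<^bsup>-s\<^esup> \<eta>)\<close> converge to \<open>(x, 0)\<close>, and there the transform decays at most like
  \<open>exp (- O (\<lambda>))\<close> with a fixed rate.\<close>

section \<open>Functions of exponential decay\<close>

lemma pow_div_fact_le_exp:
  fixes x :: real assumes "0 \<le> x" shows "x ^ n / fact n \<le> exp x"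
proof -
  have "(\<Sum>k\<in>{n}. inverse (fact k) * x ^ k) \<le> (\<Sum>k. inverse (fact k) * x ^ k)"
    using assms by (intro sum_le_suminf summable_exp) auto
  then show ?thesis by (simp add: exp_def field_simps)
qed

text \<open>Sum the bounds, weighted by \<open>2\<^sup>-\<^sup>n\<close>, over the exponential series of \<open>v / 2\<close>.\<close>

lemma exp_half_mult_le:
  fixes a v M :: real
  assumes "0 \<le> a" "0 \<le> v" and bound: "\<And>n. v ^ n / fact n * a \<le> M"
  shows "exp (v / 2) * a \<le> 2 * M"
proof -
  have "(\<lambda>n. (v / 2) ^ n /\<^sub>R fact n * a) sums (exp (v / 2) * a)"
    by (intro sums_mult2 exp_converges)
  moreover have "(\<lambda>n. (1 / 2) ^ n * M) sums (2 * M)"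
    using sums_mult2[OF geometric_sums[of "1/2 :: real"], of M] by simp
  moreover have "(v / 2) ^ n /\<^sub>R fact n * a \<le> (1 / 2) ^ n * M" for n
    using mult_left_mono[OF bound[of n], of "(1/2) ^ n"]
    by (simp add: power_divide field_simps)
  ultimately show ?thesis by (rule sums_le[rotated 1]) 
qed

text \<open>With \<open>k\<close> the integer part of the norm, the integrand is at most
  \<open>exp (- k)\<close> and the point lies in the ball of radius \<open>k + 1\<close>. The
  volumes of these balls grow only polynomially, so the series of bounds converges.\<close>

lemma integrable_exp_minus_norm:
  "integrable lborel (\<lambda>x :: 'a :: euclidean_space. exp (- norm x))"
proof (rule integrableI_bounded)
  let ?d = "DIM('a)" and ?V = "unit_ball_vol (real DIM('a))"
  define a where "a k = exp (- real k) * (?V * (real k + 1) ^ ?d)" for k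
  have a0: "0 \<le> a k" for k by (simp add: a_def)
  have "summable a"
  proof (rule summable_comparison_test'[where N = 0])
    have "exp (- (1/2)) < (1 :: real)" by simp
    then show "summable (\<lambda>k. ?V * 2 ^ ?d * fact ?d * exp (1/2) * exp (- (1/2)) ^ k)"
      by (intro summable_mult summable_geometric) auto
    fix k
    \<comment> \<open>Half of the exponential decay absorbs the polynomial factor; the other half
      leaves a geometric series of ratio \<open>exp (- (1/2))\<close>.\<close>
    have "((real k + 1) / 2) ^ ?d / fact ?d \<le> exp ((real k + 1) / 2)"
      by (rule pow_div_fact_le_exp) simp
    then have "(real k + 1) ^ ?d \<le> 2 ^ ?d * fact ?d * exp ((real k + 1) / 2)"
      by (simp add: power_divide field_simps)
    then have "a k \<le> exp (- real k) * (?V * (2 ^ ?d * fact ?d * exp ((real k + 1) / 2)))"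
      unfolding a_def by (intro mult_left_mono) auto
    also have "\<dots> = ?V * 2 ^ ?d * fact ?d * (exp (- real k) * exp ((real k + 1) / 2))"
      by simp
    also have "exp (- real k) * exp ((real k + 1) / 2) = exp (1/2) * exp (- (1/2)) ^ k"
      by (simp add: exp_of_nat_mult[symmetric] exp_add[symmetric] field_simps)
    finally show "norm (a k) \<le> ?V * 2 ^ ?d * fact ?d * exp (1/2) * exp (- (1/2)) ^ k"
      using a0[of k] by (simp add: mult_ac)
  qed
  have "(\<integral>\<^sup>+x. ennreal (exp (- norm x)) \<partial>(lborel :: 'a measure)) \<le>
    (\<integral>\<^sup>+x. (\<Sum>k. ennreal (exp (- real k)) * indicator (cball 0 (real k + 1)) x) \<partial>(lborel :: 'a measure))"
  proof (rule nn_integral_mono)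
    fix x :: 'a
    define k where "k = nat \<lfloor>norm x\<rfloor>"
    have "real k \<le> norm x" unfolding k_def by (rule of_nat_floor) simp
    moreover have "norm x \<le> real k + 1"
      unfolding k_def using floor_correct[of "norm x"] by (simp add: of_nat_nat)
    ultimately have k: "real k \<le> norm x" "norm x \<le> real k + 1" .
    have "ennreal (exp (- norm x)) \<le> ennreal (exp (- real k)) * indicator (cball 0 (real k + 1)) x"
      using k by (simp add: indicator_def)
    also have "\<dots> \<le> (\<Sum>k. ennreal (exp (- real k)) * indicator (cball 0 (real k + 1)) x)"
    proof -
      have "f k \<le> suminf f" for f :: "nat \<Rightarrow> ennreal"
        using sum_le_suminf[of f "{k}"] by simp
      then show ?thesis .
    qed
    finally show "ennreal (exp (- norm x)) \<le>
      (\<Sum>k. ennreal (exp (- real k)) * indicator (cball 0 (real k + 1)) x)" .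
  qed
  also have "\<dots> = (\<Sum>k. ennreal (exp (- real k)) * emeasure lborel (cball (0 :: 'a) (real k + 1)))"
    by (subst nn_integral_suminf)
       (auto simp: nn_integral_cmult_indicator intro!: borel_measurable_times_ennreal borel_measurable_indicator)
  also have "\<dots> = (\<Sum>k. ennreal (a k))"
    by (simp add: emeasure_cball a_def ennreal_mult)
  also have "\<dots> = ennreal (suminf a)" using \<open>summable a\<close> a0 by (simp add: suminf_ennreal2)
  also have "\<dots> < \<infinity>" by simp
  finally show "(\<integral>\<^sup>+x. ennreal (norm (exp (- norm x))) \<partial>(lborel :: 'a measure)) < \<infinity>" by simp
qed simp

lemma
  fixes k :: "'a :: euclidean_space \<Rightarrow> 'b :: {banach, second_countable_topology}"
  assumes "k \<in> borel_measurable borel" and bound: "\<And>x. norm (k x) \<le> C * exp (- norm x)"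
  shows integrable_exp_decay: "integrable lborel k"
    and norm_integral_exp_decay_le:
      "norm (integral\<^sup>L lborel k) \<le> C * (LINT x :: 'a|lborel. exp (- norm x))"
proof -
  have C: "integrable lborel (\<lambda>x :: 'a. C * exp (- norm x))"
    by (simp add: integrable_exp_minus_norm)
  show k: "integrable lborel k"
    using bound assms(1)
    by (intro Bochner_Integration.integrable_bound[OF C]) (auto intro: order_trans[OF _ abs_ge_self])
  have "norm (integral\<^sup>L lborel k) \<le> (LINT x|lborel. norm (k x))" by (rule integral_norm_bound)
  also have "\<dots> \<le> (LINT x :: 'a|lborel. C * exp (- norm x))"
    using k C bound by (intro integral_mono) auto
  finally show "norm (integral\<^sup>L lborel k) \<le> C * (LINT x :: 'a|lborel. exp (- norm x))"
    by simp
qed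

section \<open>Translation invariance and integrals of derivatives\<close>

lemma
  fixes k :: "'a :: euclidean_space \<Rightarrow> 'b :: {banach, second_countable_topology}"
  shows lborel_integrable_translation: "integrable lborel k \<Longrightarrow> integrable lborel (\<lambda>x. k (a + x))"
    and lborel_integral_translation: "integrable lborel k \<Longrightarrow> (LINT x|lborel. k (a + x)) = integral\<^sup>L lborel k"
proof -
  assume k: "integrable lborel k"
  then have [measurable]: "k \<in> borel_measurable borel" by auto
  show "integrable lborel (\<lambda>x. k (a + x))"
    by (rule integrable_distr[of "(+) a" _ borel k])
       (use k in \<open>simp_all add: lborel_distr_plus\<close>)
  show "(LINT x|lborel. k (a + x)) = integral\<^sup>L lborel k"
    by (subst (2) lborel_distr_plus[symmetric, of a], subst integral_distr) auto
qed

text \<open>By translation invariance every difference quotient of \<open>k\<close> integrates to zero, which makes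
  Fubini's theorem unnecessary.\<close>

lemma integral_directional_derivative_eq_0:
  fixes k k' :: "'a :: euclidean_space \<Rightarrow> 'b :: {banach, second_countable_topology}"
  assumes v: "norm v \<le> 1"
    and deriv: "\<And>y. ((\<lambda>h. k (y + h *\<^sub>R v)) has_vector_derivative k' y) (at 0)"
    and meas: "k \<in> borel_measurable borel" "k' \<in> borel_measurable borel"
    and bound: "\<And>y. norm (k y) \<le> C * exp (- norm y)" "\<And>y. norm (k' y) \<le> C * exp (- norm y)"
  shows "integral\<^sup>L lborel k' = 0"
proof -
  have C: "0 \<le> C" using order_trans[OF norm_ge_zero bound(1), of 0] by simp
  define q where "q n y = inverse (1 / real (Suc n)) *\<^sub>R (k (y + (1 / real (Suc n)) *\<^sub>R v) - k y)" for n y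
  have k: "integrable lborel k" using integrable_exp_decay[OF meas(1) bound(1)] .
  have int_q: "integral\<^sup>L lborel (q n) = 0" for n
    using lborel_integrable_translation[OF k, of "(1 / real (Suc n)) *\<^sub>R v"]
      lborel_integral_translation[OF k, of "(1 / real (Suc n)) *\<^sub>R v"] k
    by (simp add: q_def[abs_def] add.commute)
  \<comment> \<open>The hypothesis differentiates only at step 0, but from every base point; moving
    the base point gives the derivative along the whole line.\<close>
  have deriv_at: "((\<lambda>h. k (y + h *\<^sub>R v)) has_vector_derivative k' (y + h *\<^sub>R v)) (at h within S)" for y h S
  proof -
    have "((\<lambda>u. k ((y + h *\<^sub>R v) + u *\<^sub>R v)) has_vector_derivative k' (y + h *\<^sub>R v)) (at (h - h))"
      using deriv[of "y + h *\<^sub>R v"] by simp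
    then have "((\<lambda>u. k ((y + h *\<^sub>R v) + u *\<^sub>R v)) \<circ> (\<lambda>u. u - h) has_vector_derivative
        1 *\<^sub>R k' (y + h *\<^sub>R v)) (at h)"
      by (intro vector_diff_chain_at) (auto intro!: derivative_eq_intros)
    moreover have "(\<lambda>u. k ((y + h *\<^sub>R v) + u *\<^sub>R v)) \<circ> (\<lambda>u. u - h) = (\<lambda>u. k (y + u *\<^sub>R v))"
      by (auto simp: fun_eq_iff algebra_simps)
    ultimately show ?thesis by (auto intro: has_vector_derivative_at_within)
  qed
  have "(\<lambda>n. integral\<^sup>L lborel (q n)) \<longlonglongrightarrow> integral\<^sup>L lborel k'"
  proof (rule integral_dominated_convergence[where w = "\<lambda>y. C * exp 1 * exp (- norm y)"])
    show "k' \<in> borel_measurable lborel" using meas by simp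
    show "q n \<in> borel_measurable lborel" for n
      unfolding q_def[abs_def] using meas by measurable
    show "integrable lborel (\<lambda>y :: 'a. C * exp 1 * exp (- norm y))"
      by (simp add: integrable_exp_minus_norm)
    show "AE y in lborel. (\<lambda>n. q n y) \<longlonglongrightarrow> k' y"
    proof (rule AE_I2)
      fix y
      have "((\<lambda>h. norm (k (y + h *\<^sub>R v) - k y - h *\<^sub>R k' y) / norm h) \<longlongrightarrow> 0) (at 0)"
        using deriv[of y] by (simp add: has_vector_derivative_def has_derivative_at)
      moreover have "filterlim (\<lambda>n. 1 / real (Suc n)) (at 0) sequentially"
        using LIMSEQ_inverse_real_of_nat by (auto simp: filterlim_at inverse_eq_divide)
      ultimately have "(\<lambda>n. norm (k (y + (1 / real (Suc n)) *\<^sub>R v) - k y - (1 / real (Suc n)) *\<^sub>R k' y)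
          / norm (1 / real (Suc n))) \<longlonglongrightarrow> 0"
        by (rule filterlim_compose)
      moreover have "norm (k (y + (1 / real (Suc n)) *\<^sub>R v) - k y - (1 / real (Suc n)) *\<^sub>R k' y)
          / norm (1 / real (Suc n)) = norm (q n y - k' y)" for n
      proof -
        have "q n y - k' y = real (Suc n) *\<^sub>R
            (k (y + (1 / real (Suc n)) *\<^sub>R v) - k y - (1 / real (Suc n)) *\<^sub>R k' y)"
          by (simp add: q_def scaleR_diff_right del: of_nat_Suc)
        then show ?thesis by (simp only: norm_scaleR) (simp add: field_simps del: of_nat_Suc)
      qed
      ultimately show "(\<lambda>n. q n y) \<longlonglongrightarrow> k' y"
        by (simp add: tendsto_norm_zero_iff LIM_zero_iff del: of_nat_Suc)
    qed
    show "AE y in lborel. norm (q n y) \<le> C * exp 1 * exp (- norm y)" for n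
    proof (rule AE_I2)
      fix y
      let ?h = "1 / real (Suc n)"
      \<comment> \<open>The mean value inequality bounds the quotient by the size of
        \<open>k'\<close> on a segment of length at most 1 starting at \<open>y\<close>; moving by
        at most 1 costs the factor \<open>exp 1\<close>.\<close>
      have "norm (k (y + ?h *\<^sub>R v) - k (y + 0 *\<^sub>R v)) \<le> C * exp 1 * exp (- norm y) * norm (?h - 0)"
      proof (rule differentiable_bound[where S = "{0..1}" and f = "\<lambda>h. k (y + h *\<^sub>R v)"
            and f' = "\<lambda>h u. u *\<^sub>R k' (y + h *\<^sub>R v)"])
        fix h :: real assume h: "h \<in> {0..1}"
        show "((\<lambda>h. k (y + h *\<^sub>R v)) has_derivative (\<lambda>u. u *\<^sub>R k' (y + h *\<^sub>R v))) (at h within {0..1})"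
          using deriv_at unfolding has_vector_derivative_def .
        have "norm (h *\<^sub>R v) \<le> 1" using h v by (simp add: mult_le_one)
        then have "norm y \<le> norm (y + h *\<^sub>R v) + 1"
          using norm_triangle_ineq4[of "y + h *\<^sub>R v" "h *\<^sub>R v"] by simp
        then have "C * exp (- norm (y + h *\<^sub>R v)) \<le> C * exp 1 * exp (- norm y)"
          using C by (simp add: exp_add[symmetric] mult.assoc mult_left_mono)
        then have "norm (k' (y + h *\<^sub>R v)) \<le> C * exp 1 * exp (- norm y)"
          using bound(2) order_trans by blast
        then show "onorm (\<lambda>u. u *\<^sub>R k' (y + h *\<^sub>R v)) \<le> C * exp 1 * exp (- norm y)"
          by (intro onorm_le) (simp add: mult.commute mult_left_mono)
      qed auto
      then show "norm (q n y) \<le> C * exp 1 * exp (- norm y)"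
        unfolding q_def norm_scaleR by (simp add: field_simps del: of_nat_Suc)
    qed
  qed
  then show ?thesis using int_q LIMSEQ_unique[OF _ tendsto_const] by force
qed

section \<open>Injectivity of the Fourier transform\<close>

text \<open>Integrability is part of the notion because the integral of a non-integrable function is
  0 by convention, so that vanishing alone would say nothing about such a function.\<close>

definition fourier_null :: "('a :: euclidean_space \<Rightarrow> complex) \<Rightarrow> bool" where
  "fourier_null k \<longleftrightarrow> integrable lborel k \<and>
    (\<forall>\<xi>. (LINT y|lborel. k y * exp (\<i> * complex_of_real (y \<bullet> \<xi>))) = 0)"

lemma integrable_mult_bounded_continuous:
  fixes k q :: "'a :: euclidean_space \<Rightarrow> complex"
  assumes k: "integrable lborel k" and q: "continuous_on UNIV q" "\<And>y. norm (q y) \<le> B"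
  shows "integrable lborel (\<lambda>y. k y * q y)"
proof (rule Bochner_Integration.integrable_bound[where f = "\<lambda>y. B * norm (k y)"])
  show "integrable lborel (\<lambda>y. B * norm (k y))" using k by simp
  have "q \<in> borel_measurable borel" using q by (intro borel_measurable_continuous_onI)
  then show "(\<lambda>y. k y * q y) \<in> borel_measurable lborel"
    using borel_measurable_integrable[OF k] by (intro borel_measurable_times) simp_all
  show "AE y in lborel. norm (k y * q y) \<le> norm (B * norm (k y))"
  proof (rule AE_I2)
    fix y
    have "norm (k y) * norm (q y) \<le> norm (k y) * B" using q(2) by (intro mult_left_mono) auto
    then show "norm (k y * q y) \<le> norm (B * norm (k y))"
      by (simp add: norm_mult mult.commute)
  qed
qed

lemma integrable_mult_character:
  fixes k :: "'a :: euclidean_space \<Rightarrow> complex"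
  assumes "integrable lborel k"
  shows "integrable lborel (\<lambda>y. k y * exp (\<i> * complex_of_real (y \<bullet> \<xi>)))"
  by (rule integrable_mult_bounded_continuous[OF assms, where B = 1])
     (auto intro!: continuous_intros)

lemma fourier_null_add: "fourier_null k \<Longrightarrow> fourier_null l \<Longrightarrow> fourier_null (\<lambda>y. k y + l y)"
  by (simp add: fourier_null_def distrib_right integrable_mult_character)

lemma fourier_null_cmult: "fourier_null k \<Longrightarrow> fourier_null (\<lambda>y. c * k y)"
  by (simp add: fourier_null_def mult.assoc)

lemma fourier_null_sum:
  "(\<And>i. i \<in> I \<Longrightarrow> fourier_null (k i)) \<Longrightarrow> fourier_null (\<lambda>y. \<Sum>i\<in>I. k i y)"
proof (induction I rule: infinite_finite_induct)
  case (insert i I)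
  then show ?case using fourier_null_add[of "k i" "\<lambda>y. \<Sum>i\<in>I. k i y"] by simp
qed (simp_all add: fourier_null_def)

text \<open>Multiplication by a character translates the Fourier transform by
  \<open>\<eta>\<close>.\<close>

lemma fourier_null_character:
  assumes "fourier_null k" shows "fourier_null (\<lambda>y. k y * exp (\<i> * complex_of_real (y \<bullet> \<eta>)))"
proof -
  have "k y * exp (\<i> * complex_of_real (y \<bullet> \<eta>)) * exp (\<i> * complex_of_real (y \<bullet> \<xi>)) =
    k y * exp (\<i> * complex_of_real (y \<bullet> (\<eta> + \<xi>)))" for y \<xi>
    by (simp add: inner_add_right distrib_left exp_add mult.assoc)
  then show ?thesis using assms
    unfolding fourier_null_def by (simp only: integrable_mult_character simp_thms)
qed

text \<open>By Euler's formula the sine is a combination of the characters of frequency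
  \<open>\<eta>\<close> and \<open>- \<eta>\<close>.\<close>

lemma fourier_null_sin:
  assumes "fourier_null k" shows "fourier_null (\<lambda>y. k y * complex_of_real (sin (y \<bullet> \<eta>)))"
proof -
  have "k y * complex_of_real (sin (y \<bullet> \<eta>)) =
    (1 / (2 * \<i>)) * (k y * exp (\<i> * complex_of_real (y \<bullet> \<eta>))) +
    (- 1 / (2 * \<i>)) * (k y * exp (\<i> * complex_of_real (y \<bullet> (- \<eta>))))" for y
    by (simp add: sin_of_real[symmetric] sin_exp_eq field_simps)
  then show ?thesis
    using assms by (simp only:) (intro fourier_null_add fourier_null_cmult fourier_null_character)
qed

text \<open>Polynomials in \<open>torus_map R y\<close> are trigonometric polynomials in \<open>y\<close>, hence by
  Stone--Weierstrass every bounded continuous function of \<open>torus_map R y\<close> integrates to zero against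
  a function with vanishing Fourier transform. As \<open>torus_map R y\<close> tends to \<open>y\<close> for
  \<open>R \<rightarrow> \<infinity>\<close>, so does every bounded continuous function of \<open>y\<close>.\<close>

definition torus_map :: "real \<Rightarrow> 'a :: euclidean_space \<Rightarrow> 'a" where
  "torus_map R y = (\<Sum>b\<in>Basis. (R * sin (y \<bullet> b / R)) *\<^sub>R b)"

lemma continuous_on_torus_map: "continuous_on S (torus_map R)"
  unfolding torus_map_def by (cases "R = 0") (auto intro!: continuous_intros)

text \<open>Confines the range to one compact ball, where Stone--Weierstrass gives uniform
  approximation.\<close>

lemma norm_torus_map_le:
  assumes "0 \<le> R" shows "norm (torus_map R (y :: 'a :: euclidean_space)) \<le> R * DIM('a)"
proof -
  have "norm (torus_map R y) \<le> (\<Sum>b\<in>Basis. norm ((R * sin (y \<bullet> b / R)) *\<^sub>R b))"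
    unfolding torus_map_def by (rule norm_sum)
  also have "\<dots> \<le> (\<Sum>b\<in>(Basis :: 'a set). R)"
    using assms by (intro sum_mono) (simp add: abs_mult mult_left_le)
  finally show ?thesis by (simp add: mult.commute)
qed

text \<open>Induction on the polynomial for all \<open>k\<close> at once. A linear functional of
  \<open>torus_map R y\<close> is a combination of sines; in a product, one factor is absorbed into
  \<open>k\<close> before the other is treated.\<close>

lemma fourier_null_polynomial_torus_map:
  fixes p :: "'a :: euclidean_space \<Rightarrow> real"
  assumes "real_polynomial_function p" "fourier_null k"
  shows "fourier_null (\<lambda>y. k y * complex_of_real (p (torus_map R y)))"
  using assms
proof (induction p arbitrary: k)
  case (linear f)
  interpret bounded_linear f by fact
  have "k y * complex_of_real (f (torus_map R y)) =
    (\<Sum>b\<in>Basis. (R * f b) * (k y * complex_of_real (sin (y \<bullet> (b /\<^sub>R R)))))" for y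
    by (simp add: torus_map_def sum scaleR sum_distrib_left field_simps)
  then show ?case
    by (simp only:) (intro fourier_null_sum fourier_null_cmult fourier_null_sin linear.prems)
next
  case (const c)
  then show ?case using fourier_null_cmult[of k c] by (simp add: mult.commute)
next
  case (add f g)
  then show ?case by (simp add: distrib_left fourier_null_add)
next
  case (mult f g)
  then show ?case using mult.IH(2)[OF mult.IH(1)[OF mult.prems]] by (simp add: mult.assoc)
qed

lemma integral_torus_map_eq_0:
  fixes g :: "'a :: euclidean_space \<Rightarrow> complex" and \<phi> :: "'a \<Rightarrow> real"
  assumes g: "fourier_null g" and \<phi>: "continuous_on UNIV \<phi>" "\<And>y. \<bar>\<phi> y\<bar> \<le> B" and R: "0 \<le> R"
  shows "(LINT y|lborel. g y * complex_of_real (\<phi> (torus_map R y))) = 0"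
proof (rule ccontr)
  let ?J = "LINT y|lborel. g y * complex_of_real (\<phi> (torus_map R y))"
  let ?I = "LINT y|lborel. norm (g y)"
  assume "?J \<noteq> 0"
  \<comment> \<open>Chosen so that \<open>e * ?I < norm ?J\<close>, which contradicts the estimate
    below; the summand 1 guards against a vanishing \<open>?I\<close>.\<close>
  define e where "e = norm ?J / (?I + 1)"
  have I: "0 \<le> ?I" by simp
  have e: "0 < e" using \<open>?J \<noteq> 0\<close> I using I unfolding e_def by (intro divide_pos_pos) (simp, linarith)
  have g': "integrable lborel g" using g by (simp add: fourier_null_def)
  have "continuous_on (cball 0 (R * DIM('a))) \<phi>" using \<phi>(1) continuous_on_subset by blast
  then obtain p where p: "real_polynomial_function p"
    and close: "\<And>x. x \<in> cball 0 (R * DIM('a)) \<Longrightarrow> \<bar>\<phi> x - p x\<bar> < e"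
    using Stone_Weierstrass_real_polynomial_function[OF compact_cball _ e] by blast
  have null: "fourier_null (\<lambda>y. g y * complex_of_real (p (torus_map R y)))"
    by (rule fourier_null_polynomial_torus_map[OF p g])
  \<comment> \<open>At frequency 0 the transform is the plain integral.\<close>
  then have 0: "(LINT y|lborel. g y * complex_of_real (p (torus_map R y))) = 0"
    unfolding fourier_null_def by (auto dest!: spec[of _ 0])
  have int_p: "integrable lborel (\<lambda>y. g y * complex_of_real (p (torus_map R y)))"
    using null by (simp add: fourier_null_def)
  have int_\<phi>: "integrable lborel (\<lambda>y. g y * complex_of_real (\<phi> (torus_map R y)))"
    using \<phi> by (intro integrable_mult_bounded_continuous[OF g', where B = B] continuous_intros
        continuous_on_compose2[OF \<phi>(1)] continuous_on_torus_map) auto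
  have "?J = (LINT y|lborel. g y * complex_of_real (\<phi> (torus_map R y) - p (torus_map R y)))"
    using int_p int_\<phi> 0 by (simp add: right_diff_distrib)
  also have "norm \<dots> \<le> (LINT y|lborel. norm (g y * complex_of_real (\<phi> (torus_map R y) - p (torus_map R y))))"
    by (rule integral_norm_bound)
  also have "\<dots> \<le> (LINT y|lborel. e * norm (g y))"
  proof (rule integral_mono)
    show "integrable lborel (\<lambda>y. norm (g y * complex_of_real (\<phi> (torus_map R y) - p (torus_map R y))))"
      using int_p int_\<phi> by (simp add: right_diff_distrib)
    show "norm (g y * complex_of_real (\<phi> (torus_map R y) - p (torus_map R y))) \<le> e * norm (g y)" for y
      using close[of "torus_map R y"] norm_torus_map_le[OF R, of y]
      by (subst norm_mult, subst mult.commute, intro mult_right_mono)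
         (auto simp del: of_real_diff)
  qed (use g' in simp)
  finally have "norm ?J \<le> e * ?I" by simp
  also have "\<dots> < e * (?I + 1)" using e by simp
  also have "\<dots> = norm ?J" using I by (simp add: e_def add_nonneg_eq_0_iff)
  finally show False by simp
qed

text \<open>Coordinatewise this is the limit of \<open>sin x / x\<close> at 0, taken along
  \<open>x = a / Suc n\<close>.\<close>

lemma torus_map_tendsto: "(\<lambda>n. torus_map (real (Suc n)) y) \<longlonglongrightarrow> (y :: 'a :: euclidean_space)"
proof -
  have "(\<lambda>n. real (Suc n) * sin (a / real (Suc n))) \<longlonglongrightarrow> a" for a :: real
  proof (cases "a = 0")
    case False
    have "((\<lambda>x :: real. sin x / x) \<longlongrightarrow> 1) (at 0)"
      using DERIV_sin[of 0] by (simp add: DERIV_def)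
    moreover have "filterlim (\<lambda>n. a / real (Suc n)) (at 0) sequentially"
      using False tendsto_mult[OF tendsto_const[of a] LIMSEQ_inverse_real_of_nat]
      by (auto simp: filterlim_at divide_inverse)
    ultimately have "(\<lambda>n. sin (a / real (Suc n)) / (a / real (Suc n))) \<longlonglongrightarrow> 1"
      by (rule filterlim_compose)
    from tendsto_mult[OF tendsto_const[of a] this] False show ?thesis
      by (simp add: field_simps del: of_nat_Suc)
  qed simp
  then have "(\<lambda>n. torus_map (real (Suc n)) y) \<longlonglongrightarrow> (\<Sum>b\<in>Basis. (y \<bullet> b) *\<^sub>R b)"
    unfolding torus_map_def by (intro tendsto_intros)
  then show ?thesis by (simp add: euclidean_representation)
qed

text \<open>Dominated convergence as the scale \<open>R = Suc n\<close> grows, with majorant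
  \<open>B * norm (g y)\<close>.\<close>

lemma integral_eq_0_if_fourier_null:
  fixes g :: "'a :: euclidean_space \<Rightarrow> complex" and \<phi> :: "'a \<Rightarrow> real"
  assumes g: "fourier_null g" and \<phi>: "continuous_on UNIV \<phi>" "\<And>y. \<bar>\<phi> y\<bar> \<le> B"
  shows "(LINT y|lborel. g y * complex_of_real (\<phi> y)) = 0"
proof -
  have g': "integrable lborel g" using g by (simp add: fourier_null_def)
  have int: "integrable lborel (\<lambda>y. g y * complex_of_real (\<phi> (h y)))" if "continuous_on UNIV h" for h
    using \<phi> that by (intro integrable_mult_bounded_continuous[OF g', where B = B] continuous_intros
        continuous_on_compose2[OF \<phi>(1)]) auto
  have "(\<lambda>n. LINT y|lborel. g y * complex_of_real (\<phi> (torus_map (real (Suc n)) y))) \<longlonglongrightarrow>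
    (LINT y|lborel. g y * complex_of_real (\<phi> y))"
  proof (rule integral_dominated_convergence[where w = "\<lambda>y. B * norm (g y)"])
    show "(\<lambda>y. g y * complex_of_real (\<phi> y)) \<in> borel_measurable lborel"
      using int[of "\<lambda>y. y"] by auto
    show "(\<lambda>y. g y * complex_of_real (\<phi> (torus_map (real (Suc n)) y))) \<in> borel_measurable lborel" for n
      by (intro borel_measurable_integrable int continuous_on_torus_map)
    show "integrable lborel (\<lambda>y. B * norm (g y))" using g' by simp
    show "AE y in lborel. (\<lambda>n. g y * complex_of_real (\<phi> (torus_map (real (Suc n)) y)))
        \<longlonglongrightarrow> g y * complex_of_real (\<phi> y)"
      using \<phi>(1) by (intro AE_I2 tendsto_intros continuous_on_tendsto_compose[OF \<phi>(1) torus_map_tendsto]) auto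
    show "AE y in lborel. norm (g y * complex_of_real (\<phi> (torus_map (real (Suc n)) y))) \<le> B * norm (g y)" for n
      by (rule AE_I2) (simp add: norm_mult \<phi>(2) mult.commute[of B] mult_left_mono)
  qed
  moreover have "(LINT y|lborel. g y * complex_of_real (\<phi> (torus_map (real (Suc n)) y))) = 0" for n
    by (rule integral_torus_map_eq_0[OF g \<phi>]) simp
  ultimately show ?thesis using LIMSEQ_unique[OF _ tendsto_const] by force
qed

text \<open>Testing \<open>g\<close> against its conjugate divided by
  \<open>1 + (norm g)\<^sup>2\<close>, which is bounded and continuous, shows that a nonnegative
  function with the same zeros as \<open>g\<close> has integral 0. The test functions above are
  real, so real and imaginary parts are tested separately.\<close>

lemma fourier_null_imp_eq_0:
  fixes g :: "'a :: euclidean_space \<Rightarrow> complex"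
  assumes g: "fourier_null g" and cont: "continuous_on UNIV g"
  shows "g x = 0"
proof -
  let ?w = "\<lambda>y. 1 + (norm (g y))\<^sup>2"
  have w: "0 < ?w y" for y by (simp add: add_pos_nonneg)
  then have w0: "?w y \<noteq> 0" for y by (rule less_imp_neq[symmetric])
  have small: "\<bar>a\<bar> \<le> 1 + (norm c)\<^sup>2" if "\<bar>a\<bar> \<le> norm c" for a :: real and c :: complex
    using that zero_le_power2[of "norm c - 1"] zero_le_power2[of "norm c"]
    by (simp add: power2_diff) 
  define \<phi>1 \<phi>2 where "\<phi>1 y = Re (g y) / ?w y" and "\<phi>2 y = Im (g y) / ?w y" for y
  have cont_\<phi>: "continuous_on UNIV \<phi>1" "continuous_on UNIV \<phi>2"
    unfolding \<phi>1_def[abs_def] \<phi>2_def[abs_def] by (intro continuous_intros cont ballI w0)+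
  have bd: "\<bar>\<phi>1 y\<bar> \<le> 1" "\<bar>\<phi>2 y\<bar> \<le> 1" for y
    using w[of y] small[OF abs_Re_le_cmod, of "g y"] small[OF abs_Im_le_cmod, of "g y"]
    by (simp_all add: \<phi>1_def \<phi>2_def)
  have g': "integrable lborel g" using g by (simp add: fourier_null_def)
  have int: "integrable lborel (\<lambda>y. g y * complex_of_real (\<phi>1 y))" "integrable lborel (\<lambda>y. g y * complex_of_real (\<phi>2 y))"
    using bd cont_\<phi> by (auto intro!: integrable_mult_bounded_continuous[OF g', where B = 1] continuous_intros)
  define m where "m y = (norm (g y))\<^sup>2 / ?w y" for y
  \<comment> \<open>This combination of test functions is the conjugate of \<open>g\<close> over the
    weight, so multiplying by \<open>g\<close> produces the squared modulus.\<close>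
  have m: "complex_of_real (m y) = g y * complex_of_real (\<phi>1 y) - \<i> * (g y * complex_of_real (\<phi>2 y))" for y
  proof -
    have "complex_of_real (\<phi>1 y) - \<i> * complex_of_real (\<phi>2 y) = cnj (g y) / complex_of_real (?w y)"
      unfolding \<phi>1_def \<phi>2_def complex_eq_iff Re_divide_of_real Im_divide_of_real by simp
    then have "g y * (complex_of_real (\<phi>1 y) - \<i> * complex_of_real (\<phi>2 y)) = complex_of_real (m y)"
      unfolding m_def of_real_divide complex_norm_square times_divide_eq_right by simp
    then show ?thesis by (simp add: right_diff_distrib mult.left_commute)
  qed
  have int_m: "integrable lborel (\<lambda>y. complex_of_real (m y))" unfolding m using int by simp
  then have int_m': "integrable lborel m" using integrable_Re by fastforce
  have "complex_of_real (integral\<^sup>L lborel m) = (LINT y|lborel. complex_of_real (m y))" by simp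
  also have "\<dots> = 0" unfolding m
    using int integral_eq_0_if_fourier_null[OF g cont_\<phi>(1) bd(1)] integral_eq_0_if_fourier_null[OF g cont_\<phi>(2) bd(2)]
    by simp
  finally have "integral\<^sup>L lborel m = 0" by simp
  then have "AE y in lborel. m y = 0"
    using integral_nonneg_eq_0_iff_AE[OF int_m'] w by (simp add: m_def less_imp_le)
  then have "AE y in lborel. y \<in> {y. g y = 0}"
    by eventually_elim (use w0 in \<open>auto simp: m_def\<close>)
  \<comment> \<open>Continuity enters here: a closed set whose complement is null is the whole
    space.\<close>
  moreover have "closed {y. g y = 0}"
    using continuous_closed_preimage_constant[OF cont closed_UNIV, of 0] by simp
  ultimately have "x \<in> {y. g y = 0}" using mem_closed_if_AE_lebesgue AE_completion by blast
  then show ?thesis by simp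
qed

section \<open>Gelfand--Shilov functions against exponentials\<close>

text \<open>Raising the bounds to the power \<open>1 / s\<close> turns \<open>fact n powr s\<close>
  into \<open>fact n\<close>. The exponential series then applies to \<open>x powr (1 / s)\<close>,
  and the power \<open>s\<close> undoes the first step.\<close>

lemma exp_half_powr_mult_le:
  fixes a x M s :: real
  assumes s: "0 < s" and a: "0 \<le> a" and x: "0 \<le> x" and M: "0 \<le> M"
    and bound: "\<And>n. x ^ n * a \<le> M * fact n powr s"
  shows "exp (s / 2 * x powr (1 / s)) * a \<le> 2 powr s * M"
proof -
  have pow: "(x powr (1 / s)) ^ n = (x ^ n) powr (1 / s)" for n
    using x by (induction n) (simp_all add: powr_mult)
  have "(x powr (1 / s)) ^ n / fact n * a powr (1 / s) \<le> M powr (1 / s)" for n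
  proof -
    have "(x ^ n * a) powr (1 / s) \<le> (M * fact n powr s) powr (1 / s)"
      using bound[of n] s a x by (intro powr_mono2) auto
    also have "\<dots> = M powr (1 / s) * fact n"
      using M s by (simp add: powr_mult powr_powr)
    finally show ?thesis using x a by (simp add: pow powr_mult field_simps)
  qed
  then have "exp (x powr (1 / s) / 2) * a powr (1 / s) \<le> 2 * M powr (1 / s)"
    by (intro exp_half_mult_le) auto
  then have "(exp (x powr (1 / s) / 2) * a powr (1 / s)) powr s \<le> (2 * M powr (1 / s)) powr s"
    using s by (intro powr_mono2) auto
  then show ?thesis
    using a M s by (simp add: powr_mult powr_powr exp_powr_real mult.commute)
qed

section \<open>Pointwise bounds from the seminorms\<close>

text \<open>The seminorms are evaluated at such multi-indices only: powers of one coordinate yield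
  decay, derivatives in one direction serve partial integration.\<close>

definition single_index :: "'n \<Rightarrow> nat \<Rightarrow> 'n \<Rightarrow> nat" where
  "single_index i m = (\<lambda>k. if k = i then m else 0)"

lemma mi_fact_single_index [simp]: "mi_fact (single_index i m) = fact m"
proof -
  have "mi_fact (single_index i m) = (\<Prod>k\<in>UNIV. if k = i then fact m else 1)"
    unfolding mi_fact_def single_index_def by (rule prod.cong) auto
  then show ?thesis by simp
qed

lemma mi_power_single_index [simp]: "mi_power x (single_index i m) = (x $ i) ^ m"
proof -
  have "mi_power x (single_index i m) = (\<Prod>k\<in>UNIV. if k = i then (x $ i) ^ m else 1)"
    unfolding mi_power_def single_index_def by (rule prod.cong) auto
  then show ?thesis by simp
qed

lemma mi_abs_single_index_add [simp]:
  "mi_abs (\<lambda>k. single_index i m k + single_index j n k) = m + n"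
  by (simp add: mi_abs_def single_index_def sum.distrib)

lemma mi_deriv_single_index [simp]: "mi_deriv (single_index j n) f = (partial_deriv j ^^ n) f"
proof -
  have "\<exists>is :: 'a list. distinct is \<and> set is = UNIV"
    using finite_distinct_list[OF finite[of UNIV]] by blast
  then have "distinct (coords :: 'a list)" "set (coords :: 'a list) = UNIV"
    unfolding coords_def by (rule someI2_ex, blast)+
  \<comment> \<open>Of \<open>coords\<close> only distinctness and completeness are known, so the
    claim is generalised to distinct lists that may or may not contain \<open>j\<close>.\<close>
  moreover have "foldr (\<lambda>i. partial_deriv i ^^ single_index j n i) is f =
      (if j \<in> set is then (partial_deriv j ^^ n) f else f)" if "distinct is" for "is"
    using that by (induction "is") (auto simp: single_index_def)
  ultimately show ?thesis by (simp add: mi_deriv_def)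
qed

lemma gs_norm_bound:
  assumes h: "0 < h" and C: "0 \<le> C" "gs_norm t s h f \<le> ennreal C"
  shows "\<bar>x $ i\<bar> ^ m * cmod ((partial_deriv j ^^ n) f x) \<le>
    C * (h ^ (m + n) * fact m powr t * fact n powr s)"
proof -
  let ?\<alpha> = "single_index i m" and ?\<beta> = "single_index j n"
  let ?Q = "\<lambda>(\<alpha>, \<beta>, x). ennreal (cmod (complex_of_real (mi_power x \<alpha>) * mi_D \<beta> f x) /
        (h ^ mi_abs (\<lambda>i. \<alpha> i + \<beta> i) * mi_fact \<alpha> powr t * mi_fact \<beta> powr s))"
  have "?Q (?\<alpha>, ?\<beta>, x) \<le> gs_norm t s h f"
    unfolding gs_norm_def by (rule SUP_upper) simp
  also note C(2)
  finally have "cmod (complex_of_real (mi_power x ?\<alpha>) * mi_D ?\<beta> f x) /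
        (h ^ mi_abs (\<lambda>i. ?\<alpha> i + ?\<beta> i) * mi_fact ?\<alpha> powr t * mi_fact ?\<beta> powr s) \<le> C"
    using C(1) by (simp only: prod.case ennreal_le_iff)
  moreover have "0 < h ^ (m + n) * fact m powr t * fact n powr s"
    using h by simp
  ultimately show ?thesis
    by (simp add: mi_D_def norm_mult norm_power power_abs divide_le_eq)
qed

text \<open>The witness is a coordinate of maximal modulus; its powers control those of the whole
  norm.\<close>

lemma norm_le_card_mult_component:
  fixes x :: "real ^ 'n::finite"
  obtains i where "norm x \<le> real CARD('n) * \<bar>x $ i\<bar>"
proof -
  have "Max (range (\<lambda>k. \<bar>x $ k\<bar>)) \<in> range (\<lambda>k. \<bar>x $ k\<bar>)" by (intro Max_in) auto
  then obtain i where i: "Max (range (\<lambda>k. \<bar>x $ k\<bar>)) = \<bar>x $ i\<bar>" by blast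
  have "norm x \<le> (\<Sum>k\<in>UNIV. \<bar>x $ k\<bar>)" by (rule norm_le_l1_cart)
  also have "\<dots> \<le> (\<Sum>k\<in>(UNIV :: 'n set). \<bar>x $ i\<bar>)"
    unfolding i[symmetric] by (intro sum_mono Max_ge) auto
  finally show ?thesis using that by simp
qed

text \<open>For \<open>t \<le> 1\<close> the factor \<open>fact m powr t\<close> is at most
  \<open>fact m\<close>, so the bounds for all powers \<open>m\<close> of a largest coordinate
  combine to exponential decay. A smaller \<open>h\<close> gives a faster rate.\<close>

lemma gs_norm_exp_bound:
  fixes f :: "real ^ 'n::finite \<Rightarrow> complex"
  assumes h: "0 < h" and C: "0 \<le> C" "gs_norm t s h f \<le> ennreal C" and t: "t \<le> 1"
  shows "exp (norm x / (2 * h * real CARD('n))) * cmod ((partial_deriv j ^^ n) f x) \<le>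
    2 * (C * (h ^ n * fact n powr s))"
proof -
  obtain i where i: "norm x \<le> real CARD('n) * \<bar>x $ i\<bar>" by (rule norm_le_card_mult_component)
  let ?a = "cmod ((partial_deriv j ^^ n) f x)"
  have "(\<bar>x $ i\<bar> / h) ^ m / fact m * ?a \<le> C * (h ^ n * fact n powr s)" for m
  proof -
    have "fact m powr t \<le> (fact m :: real)"
      using powr_mono[OF t fact_ge_1, of m] by simp
    then have "C * (h ^ (m + n) * fact m powr t * fact n powr s) \<le> C * (h ^ (m + n) * fact m * fact n powr s)"
      using C h by (intro mult_left_mono mult_right_mono) auto
    from order_trans[OF gs_norm_bound[OF h C, where x = x and i = i and m = m and j = j and n = n] this] show ?thesis
      using h by (simp add: power_divide power_add field_simps)
  qed
  then have *: "exp (\<bar>x $ i\<bar> / h / 2) * ?a \<le> 2 * (C * (h ^ n * fact n powr s))"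
    using h by (intro exp_half_mult_le) auto
  have "norm x / (2 * h * real CARD('n)) \<le> \<bar>x $ i\<bar> / h / 2"
    using i h by (simp add: field_simps)
  then have "exp (norm x / (2 * h * real CARD('n))) * ?a \<le> exp (\<bar>x $ i\<bar> / h / 2) * ?a"
    by (intro mult_right_mono) auto
  with * show ?thesis by linarith
qed

section \<open>Complex exponentials against derivatives of test functions\<close>

definition re_vec :: "complex ^ 'n \<Rightarrow> real ^ 'n::finite" where
  "re_vec w = (\<chi> j. Re (w $ j))"

lemma cmod_exp_bilin: "cmod (exp (bilin x w)) = exp (x \<bullet> re_vec w)"
  by (simp add: bilin_def re_vec_def inner_vec_def)

lemma bilin_add_left: "bilin (x + y) w = bilin x w + bilin y w"
  by (simp add: bilin_def distrib_right sum.distrib)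

lemma bilin_scaleR_axis: "bilin (c *\<^sub>R axis j 1) w = complex_of_real c * w $ j"
proof -
  have "bilin (c *\<^sub>R axis j 1) w = (\<Sum>i\<in>UNIV. if i = j then complex_of_real c * w $ j else 0)"
    unfolding bilin_def by (rule sum.cong) (auto simp: axis_def)
  then show ?thesis by simp
qed

lemma continuous_on_bilin: "continuous_on S (\<lambda>x. bilin x w)"
  unfolding bilin_def by (intro continuous_intros)

text \<open>The condition on \<open>h\<close> makes the decay rate of the derivative at least
  \<open>norm (re_vec w) + 1\<close>: the first summand absorbs the growth of the exponential, the
  second leaves \<open>exp (- norm x)\<close>. Measurability is a hypothesis of its own so that the
  estimate for \<open>n = 0\<close> also applies to differences of test functions.\<close>

lemma
  fixes f :: "real ^ 'n::finite \<Rightarrow> complex" and w :: "complex ^ 'n"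
  assumes h: "0 < h" "(norm (re_vec w) + 1) * (2 * h * real CARD('n)) \<le> 1"
    and C: "0 \<le> C" "gs_norm t s h f \<le> ennreal C" and t: "t \<le> 1"
    and meas: "(partial_deriv j ^^ n) f \<in> borel_measurable borel"
  defines "k \<equiv> (\<lambda>x. exp (bilin x w) * cnj ((partial_deriv j ^^ n) f x))"
  shows exp_bilin_mult_bound: "cmod (k x) \<le> 2 * (C * (h ^ n * fact n powr s)) * exp (- norm x)"
    and exp_bilin_mult_measurable: "k \<in> borel_measurable borel"
    and exp_bilin_mult_integrable: "integrable lborel k"
    and dist_of_fun_exp_bilin_le: "cmod (dist_of_fun (\<lambda>x. exp (bilin x w)) ((partial_deriv j ^^ n) f)) \<le>
      2 * (C * (h ^ n * fact n powr s)) * (LINT x :: real ^ 'n|lborel. exp (- norm x))"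
proof -
  show bound: "cmod (k x) \<le> 2 * (C * (h ^ n * fact n powr s)) * exp (- norm x)" for x
  proof -
    let ?a = "cmod ((partial_deriv j ^^ n) f x)"
    have "x \<bullet> re_vec w + norm x \<le> norm x * (norm (re_vec w) + 1)"
      using norm_cauchy_schwarz[of x "re_vec w"] by (simp add: distrib_left)
    also have "\<dots> \<le> norm x * (1 / (2 * h * real CARD('n)))"
      using h by (intro mult_left_mono) (simp_all add: field_simps)
    finally have "exp (x \<bullet> re_vec w + norm x) * ?a \<le> exp (norm x / (2 * h * real CARD('n))) * ?a"
      by (intro mult_right_mono) auto
    also have "\<dots> \<le> 2 * (C * (h ^ n * fact n powr s))"
      by (rule gs_norm_exp_bound[OF h(1) C t])
    finally have "exp (x \<bullet> re_vec w + norm x) * ?a * exp (- norm x) \<le>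
        2 * (C * (h ^ n * fact n powr s)) * exp (- norm x)"
      by (rule mult_right_mono) simp
    moreover have "exp (x \<bullet> re_vec w + norm x) * ?a * exp (- norm x) = cmod (k x)"
      unfolding k_def norm_mult cmod_exp_bilin complex_mod_cnj exp_add
      by (simp add: exp_minus)
    ultimately show ?thesis by simp
  qed
  have "(\<lambda>x. exp (bilin x w)) \<in> borel_measurable borel"
    by (intro borel_measurable_continuous_onI continuous_intros continuous_on_bilin)
  moreover have "(\<lambda>x. cnj ((partial_deriv j ^^ n) f x)) \<in> borel_measurable borel"
    using meas by (rule measurable_compose)
      (intro borel_measurable_continuous_onI continuous_intros)
  ultimately show k: "k \<in> borel_measurable borel" unfolding k_def by (rule borel_measurable_times)
  show "integrable lborel k" using k bound by (rule integrable_exp_decay)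
  show "cmod (dist_of_fun (\<lambda>x. exp (bilin x w)) ((partial_deriv j ^^ n) f)) \<le>
      2 * (C * (h ^ n * fact n powr s)) * (LINT x :: real ^ 'n|lborel. exp (- norm x))"
    using norm_integral_exp_decay_le[OF k bound] by (simp add: dist_of_fun_def k_def)
qed

lemma smooth_iterated_partial_deriv:
  assumes "smooth f"
  shows "(partial_deriv j ^^ n) f differentiable_on UNIV"
proof -
  have "foldr partial_deriv (replicate n j) f = (partial_deriv j ^^ n) f"
    by (induction n) auto
  then show ?thesis using assms unfolding smooth_def by metis
qed

lemma smooth_iterated_partial_deriv_measurable:
  "smooth f \<Longrightarrow> (partial_deriv j ^^ n) f \<in> borel_measurable borel"
  by (intro borel_measurable_continuous_onI differentiable_imp_continuous_on
      smooth_iterated_partial_deriv)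

text \<open>\<open>vector_derivative\<close> is a choice that is meaningful only when a derivative
  exists; total differentiability along the line provides it.\<close>

lemma partial_deriv_works:
  assumes "f differentiable_on UNIV"
  shows "((\<lambda>h. f (y + h *\<^sub>R axis j 1)) has_vector_derivative partial_deriv j f y) (at 0)"
proof -
  have "f differentiable (at (y + 0 *\<^sub>R axis j 1))"
    using assms by (simp add: differentiable_on_def)
  then have "(f \<circ> (\<lambda>h. y + h *\<^sub>R axis j 1)) differentiable (at (0 :: real))"
    by (intro differentiable_chain_at derivative_intros) auto
  then show ?thesis
    unfolding partial_deriv_def vector_derivative_works[symmetric] by (simp add: o_def)
qed

lemma gelfand_shilov_bound:
  assumes "f \<in> gelfand_shilov t s" "0 < h"
  obtains C where "0 \<le> C" "gs_norm t s h f \<le> ennreal C"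
proof -
  have "gs_norm t s h f < \<infinity>" using assms by (simp add: gelfand_shilov_def)
  then show ?thesis using that by (cases "gs_norm t s h f") auto
qed

lemma ex_small_h:
  fixes w :: "complex ^ 'n::finite"
  obtains h where "0 < h" "(norm (re_vec w) + 1) * (2 * h * real CARD('n)) \<le> 1"
proof
  let ?B = "(norm (re_vec w) + 1) * (2 * real CARD('n))"
  have B: "0 < ?B" by (intro mult_pos_pos add_nonneg_pos) auto
  then show "0 < 1 / ?B" by simp
  have "(norm (re_vec w) + 1) * (2 * (1 / ?B) * real CARD('n)) = ?B * (1 / ?B)" by (simp add: mult_ac)
  then show "(norm (re_vec w) + 1) * (2 * (1 / ?B) * real CARD('n)) \<le> 1" using B by simp
qed

section \<open>Partial integration and decay in the frequency\<close>

lemma dist_of_fun_partial_deriv: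
  fixes f :: "real ^ 'n::finite \<Rightarrow> complex"
  assumes f: "f \<in> gelfand_shilov t s" and t: "t \<le> 1"
  shows "dist_of_fun (\<lambda>x. exp (bilin x w)) ((partial_deriv j ^^ Suc n) f) =
    - (w $ j) * dist_of_fun (\<lambda>x. exp (bilin x w)) ((partial_deriv j ^^ n) f)"
proof -
  obtain h where h: "0 < h" "(norm (re_vec w) + 1) * (2 * h * real CARD('n)) \<le> 1"
    by (rule ex_small_h)
  obtain C where C: "0 \<le> C" "gs_norm t s h f \<le> ennreal C"
    using f h(1) by (rule gelfand_shilov_bound)
  have smooth: "smooth f" using f by (simp add: gelfand_shilov_def)
  define k where "k n x = exp (bilin x w) * cnj ((partial_deriv j ^^ n) f x)" for n x
  define D where "D n = 2 * (C * (h ^ n * fact n powr s))" for n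
  note meas = smooth_iterated_partial_deriv_measurable[OF smooth]
  have k: "cmod (k n x) \<le> D n * exp (- norm x)" "k n \<in> borel_measurable borel" "integrable lborel (k n)" for n x
    unfolding k_def D_def
    by (rule exp_bilin_mult_bound[OF h C t meas] exp_bilin_mult_measurable[OF h C t meas]
        exp_bilin_mult_integrable[OF h C t meas])+
  \<comment> \<open>By the product rule, the derivative of \<open>k n\<close> in the direction
    \<open>axis j 1\<close>; that its integral vanishes is the claim.\<close>
  define k' where "k' x = w $ j * k n x + k (Suc n) x" for x
  have D: "0 \<le> D n" for n using h C by (simp add: D_def)
  have "integral\<^sup>L lborel k' = 0"
  proof (rule integral_directional_derivative_eq_0[where k = "k n" and v = "axis j 1"])
    \<comment> \<open>One constant that dominates both \<open>k n\<close> and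
      \<open>k'\<close>.\<close>
    let ?E = "D n + cmod (w $ j) * D n + D (Suc n)"
    show "norm (axis j 1 :: real ^ 'n) \<le> 1" by (simp add: norm_axis_1)
    show "k n \<in> borel_measurable borel" by (rule k)
    show "k' \<in> borel_measurable borel" unfolding k'_def using k(2) by measurable
    show "cmod (k n y) \<le> ?E * exp (- norm y)" for y
    proof -
      have "D n * exp (- norm y) \<le> ?E * exp (- norm y)"
        using D by (intro mult_right_mono) auto
      then show ?thesis using k(1)[of n y] by linarith
    qed
    show "cmod (k' y) \<le> ?E * exp (- norm y)" for y
    proof -
      have "cmod (k' y) \<le> cmod (w $ j) * cmod (k n y) + cmod (k (Suc n) y)"
        unfolding k'_def by (rule order_trans[OF norm_triangle_ineq]) (simp add: norm_mult)
      also have "\<dots> \<le> cmod (w $ j) * (D n * exp (- norm y)) + D (Suc n) * exp (- norm y)"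
        by (intro add_mono mult_left_mono k) auto
      also have "\<dots> \<le> ?E * exp (- norm y)" using D[of n] by (simp add: distrib_right)
      finally show ?thesis .
    qed
    show "((\<lambda>h. k n (y + h *\<^sub>R axis j 1)) has_vector_derivative k' y) (at 0)" for y
    proof -
      note der = partial_deriv_works[OF smooth_iterated_partial_deriv[OF smooth, where j = j and n = n], of y j]
      have "((\<lambda>h. exp (bilin y w + complex_of_real h * w $ j)) has_vector_derivative exp (bilin y w) * w $ j) (at 0)"
        by (rule has_vector_derivative_real_field) (auto intro!: derivative_eq_intros)
      from has_vector_derivative_mult[OF this bounded_linear.has_vector_derivative[OF bounded_linear_cnj der]]
      show ?thesis
        by (simp add: k_def k'_def bilin_add_left bilin_scaleR_axis mult_ac add.commute)
    qed
  qed
  moreover have "integral\<^sup>L lborel k' = w $ j * integral\<^sup>L lborel (k n) + integral\<^sup>L lborel (k (Suc n))"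
    unfolding k'_def using k(3) by simp
  ultimately show ?thesis
    by (simp add: dist_of_fun_def k_def[abs_def] add_eq_0_iff)
qed

lemma dist_of_fun_iterated_partial_deriv:
  fixes f :: "real ^ 'n::finite \<Rightarrow> complex"
  assumes "f \<in> gelfand_shilov t s" "t \<le> 1"
  shows "dist_of_fun (\<lambda>x. exp (bilin x w)) ((partial_deriv j ^^ n) f) =
    (- (w $ j)) ^ n * dist_of_fun (\<lambda>x. exp (bilin x w)) f"
proof (induction n)
  case (Suc n)
  show ?case unfolding dist_of_fun_partial_deriv[OF assms] Suc.IH by simp
qed simp

text \<open>Partial integration trades \<open>n\<close> factors \<open>w $ j\<close> for
  \<open>n\<close> derivatives, which cost \<open>h ^ n * fact n powr s\<close>. The estimates
  involve \<open>w\<close> only through \<open>re_vec w\<close>, so \<open>K\<close> is uniform over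
  all imaginary parts.\<close>

lemma dist_of_fun_exp_bilin_decay:
  fixes f :: "real ^ 'n::finite \<Rightarrow> complex" and v :: "real ^ 'n"
  assumes f: "f \<in> gelfand_shilov t s" and t: "t \<le> 1" and s: "0 < s" and q: "0 < q"
  obtains K where "0 \<le> K" "\<And>w. re_vec w = v \<Longrightarrow>
    exp (q * cmod (w $ j) powr (1 / s)) * cmod (dist_of_fun (\<lambda>x. exp (bilin x w)) f) \<le> K"
proof -
  obtain h1 where h1: "0 < h1" "(norm v + 1) * (2 * h1 * real CARD('n)) \<le> 1"
    using ex_small_h[of "\<chi> i. complex_of_real (v $ i)"] by (auto simp: re_vec_def)
  \<comment> \<open>The first entry makes the integrals converge; the second makes the resulting
    rate at least \<open>q\<close>.\<close>
  define h where "h = min h1 ((s / (2 * q)) powr s)"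
  have h: "0 < h" using h1 s q by (simp add: h_def)
  have "(norm v + 1) * (2 * h * real CARD('n)) \<le> (norm v + 1) * (2 * h1 * real CARD('n))"
    by (intro mult_left_mono mult_right_mono) (auto simp: h_def)
  with h1 have h': "(norm v + 1) * (2 * h * real CARD('n)) \<le> 1" by linarith
  have "h powr (1 / s) \<le> ((s / (2 * q)) powr s) powr (1 / s)"
    using h s by (intro powr_mono2) (auto simp: h_def)
  then have hq: "h powr (1 / s) \<le> s / (2 * q)" using s q by (simp add: powr_powr)
  obtain C where C: "0 \<le> C" "gs_norm t s h f \<le> ennreal C"
    using f h by (rule gelfand_shilov_bound)
  define M where "M = 2 * C * (LINT x :: real ^ 'n|lborel. exp (- norm x))"
  have M: "0 \<le> M" using C by (auto simp: M_def intro!: mult_nonneg_nonneg)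
  have smooth: "smooth f" using f by (simp add: gelfand_shilov_def)
  show thesis
  proof
    show "0 \<le> 2 powr s * M" using M by simp
    fix w :: "complex ^ 'n" assume w: "re_vec w = v"
    let ?u = "dist_of_fun (\<lambda>x. exp (bilin x w)) f"
    have "(cmod (w $ j) / h) ^ n * cmod ?u \<le> M * fact n powr s" for n
    proof -
      have "cmod (w $ j) ^ n * cmod ?u = cmod (dist_of_fun (\<lambda>x. exp (bilin x w)) ((partial_deriv j ^^ n) f))"
        by (simp add: dist_of_fun_iterated_partial_deriv[OF f t] norm_mult norm_power)
      also have "\<dots> \<le> 2 * (C * (h ^ n * fact n powr s)) * (LINT x :: real ^ 'n|lborel. exp (- norm x))"
        using h h' w C t smooth_iterated_partial_deriv_measurable[OF smooth]
        by (intro dist_of_fun_exp_bilin_le[where t = t and s = s]) auto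
      also have "\<dots> = h ^ n * (M * fact n powr s)" by (simp add: M_def mult_ac)
      finally show ?thesis using h by (simp add: power_divide field_simps)
    qed
    then have *: "exp (s / 2 * (cmod (w $ j) / h) powr (1 / s)) * cmod ?u \<le> 2 powr s * M"
      using s M h by (intro exp_half_powr_mult_le) auto
    have "q * cmod (w $ j) powr (1 / s) \<le> s / 2 * (cmod (w $ j) / h) powr (1 / s)"
    proof -
      have "q * h powr (1 / s) \<le> s / 2" using hq q by (simp add: field_simps)
      then have "q * h powr (1 / s) * (cmod (w $ j) / h) powr (1 / s) \<le> s / 2 * (cmod (w $ j) / h) powr (1 / s)"
        by (intro mult_right_mono) auto
      then show ?thesis using h by (simp add: powr_divide)
    qed
    then have "exp (q * cmod (w $ j) powr (1 / s)) * cmod ?u \<le>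
        exp (s / 2 * (cmod (w $ j) / h) powr (1 / s)) * cmod ?u"
      by (intro mult_right_mono) auto
    with * show "exp (q * cmod (w $ j) powr (1 / s)) * cmod ?u \<le> 2 powr s * M" by linarith
  qed
qed

section \<open>The wave front set\<close>

text \<open>\<open>twist z \<xi>\<close> is \<open>z - i\<xi>\<close>, which absorbs the modulation by \<open>\<xi>\<close> into the exponential.\<close>

definition twist :: "complex ^ 'n \<Rightarrow> real ^ 'n \<Rightarrow> complex ^ 'n::finite" where
  "twist z \<xi> = (\<chi> j. z $ j - \<i> * complex_of_real (\<xi> $ j))"

lemma re_vec_twist [simp]: "re_vec (twist z \<xi>) = re_vec z"
  by (simp add: re_vec_def twist_def)

lemma exp_bilin_twist:
  "exp (bilin x (twist z \<xi>)) = exp (bilin x z) * exp (- \<i> * complex_of_real (x \<bullet> \<xi>))"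
proof -
  have "bilin x (twist z \<xi>) = bilin x z - \<i> * complex_of_real (x \<bullet> \<xi>)"
    by (simp add: bilin_def twist_def inner_vec_def sum_subtractf sum_distrib_left right_diff_distrib mult_ac)
  then show ?thesis by (simp add: exp_add[symmetric])
qed

lemma gelfand_shilov_integrable_exp_bilin:
  fixes f :: "real ^ 'n::finite \<Rightarrow> complex"
  assumes f: "f \<in> gelfand_shilov t s" and t: "t \<le> 1"
  shows "integrable lborel (\<lambda>x. exp (bilin x w) * cnj (f x))"
proof -
  obtain h where h: "0 < h" "(norm (re_vec w) + 1) * (2 * h * real CARD('n)) \<le> 1"
    by (rule ex_small_h)
  obtain C where C: "0 \<le> C" "gs_norm t s h f \<le> ennreal C"
    using f h(1) by (rule gelfand_shilov_bound)
  have "smooth f" using f by (simp add: gelfand_shilov_def)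
  from exp_bilin_mult_integrable[OF h C t, where n = 0] smooth_iterated_partial_deriv_measurable[OF this, where n = 0]
  show ?thesis by simp
qed

text \<open>Shifting the integration variable by \<open>x\<close> pulls out
  \<open>exp (bilin x (twist z \<xi>))\<close>, whose modulus depends only on
  \<open>re_vec z\<close>.\<close>

lemma cmod_stft_exp_bilin:
  fixes \<psi> :: "real ^ 'n::finite \<Rightarrow> complex"
  assumes \<psi>: "\<psi> \<in> gelfand_shilov t s" and t: "t \<le> 1"
  shows "cmod (stft \<psi> (dist_of_fun (\<lambda>x. exp (bilin x z))) x \<xi>) =
    (2 * pi) powr (- real CARD('n) / 2) * (exp (x \<bullet> re_vec z) *
      cmod (dist_of_fun (\<lambda>x. exp (bilin x (twist z \<xi>))) \<psi>))"
proof -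
  let ?w = "twist z \<xi>"
  let ?k = "\<lambda>y. exp (bilin y ?w) * cnj (\<psi> y)"
  have "dist_of_fun (\<lambda>x. exp (bilin x z)) (modulation \<xi> (translation x \<psi>)) =
      (LINT y|lborel. exp (bilin x ?w) * ?k (- x + y))"
    unfolding dist_of_fun_def
  proof (rule Bochner_Integration.integral_cong[OF refl])
    fix y
    have "exp (bilin x ?w) * exp (bilin (- x + y) ?w) = exp (bilin y ?w)"
      by (simp add: exp_add[symmetric] bilin_add_left[symmetric])
    then show "exp (bilin y z) * cnj (modulation \<xi> (translation x \<psi>) y) =
        exp (bilin x ?w) * ?k (- x + y)"
      by (simp only: mult.assoc[symmetric])
         (simp add: modulation_def translation_def exp_bilin_twist exp_cnj mult_ac)
  qed
  also have "\<dots> = exp (bilin x ?w) * (LINT y|lborel. ?k (- x + y))" by (rule integral_mult_right_zero)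
  also have "(LINT y|lborel. ?k (- x + y)) = integral\<^sup>L lborel ?k"
    by (rule lborel_integral_translation[OF gelfand_shilov_integrable_exp_bilin[OF \<psi> t]])
  finally show ?thesis
    unfolding stft_def norm_mult by (simp only: norm_mult cmod_exp_bilin re_vec_twist dist_of_fun_def)
      (simp add: dist_of_fun_def)
qed

text \<open>These values are the Fourier transform of
  \<open>exp (bilin x z) * cnj (\<psi> x)\<close>, with the sign of the frequency reversed. Were
  they all 0, this continuous function and hence \<open>\<psi>\<close> would vanish.\<close>

lemma ex_dist_of_fun_exp_bilin_twist_neq_0:
  fixes \<psi> :: "real ^ 'n::finite \<Rightarrow> complex"
  assumes \<psi>: "\<psi> \<in> gelfand_shilov t s" "\<psi> \<noteq> (\<lambda>x. 0)" and t: "t \<le> 1"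
  obtains \<xi> where "dist_of_fun (\<lambda>x. exp (bilin x (twist z \<xi>))) \<psi> \<noteq> 0"
proof (rule ccontr)
  assume "\<not> thesis"
  with that have 0: "dist_of_fun (\<lambda>x. exp (bilin x (twist z \<xi>))) \<psi> = 0" for \<xi> by blast
  let ?g = "\<lambda>x. exp (bilin x z) * cnj (\<psi> x)"
  have "?g y * exp (\<i> * complex_of_real (y \<bullet> \<xi>)) = exp (bilin y (twist z (- \<xi>))) * cnj (\<psi> y)" for y \<xi>
    by (simp add: exp_bilin_twist mult_ac)
  then have "(LINT y|lborel. ?g y * exp (\<i> * complex_of_real (y \<bullet> \<xi>))) = 0" for \<xi>
    using 0[of "- \<xi>"] by (simp only: dist_of_fun_def)
  then have "fourier_null ?g"
    by (simp only: fourier_null_def gelfand_shilov_integrable_exp_bilin[OF \<psi>(1) t] simp_thms)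
  moreover have "continuous_on UNIV \<psi>"
    using \<psi>(1) smooth_iterated_partial_deriv[where f = \<psi> and n = 0] differentiable_imp_continuous_on
    by (force simp: gelfand_shilov_def)
  then have "continuous_on UNIV ?g" by (intro continuous_intros continuous_on_bilin)
  ultimately have "?g x = 0" for x by (rule fourier_null_imp_eq_0)
  then show False using \<psi>(2) by auto
qed

section \<open>The exponential as an element of the dual\<close>

lemma gs_norm_zero: "gs_norm t s h (\<lambda>x. 0) = 0"
proof -
  have "partial_deriv i (\<lambda>x. 0) = (\<lambda>x. 0)" for i :: 'a
    by (simp add: partial_deriv_def fun_eq_iff)
  then have pow: "(partial_deriv i ^^ n) (\<lambda>x. 0) = (\<lambda>x. 0)" for i :: 'a and n
    by (induction n) simp_all
  have "foldr (\<lambda>i. partial_deriv i ^^ \<beta> i) is (\<lambda>x. 0) = (\<lambda>x. 0)" for \<beta> and "is" :: "'a list"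
    by (induction "is") (simp_all add: pow)
  then show ?thesis by (simp add: gs_norm_def mi_D_def mi_deriv_def case_prod_unfold)
qed

text \<open>One seminorm, with \<open>h\<close> small enough for \<open>z\<close>, already controls
  the functional, so around each point of a preimage a single generator of the topology fits inside
  it.\<close>

lemma dist_of_fun_exp_bilin_in_gs_dual:
  fixes z :: "complex ^ 'n::finite"
  assumes t: "t \<le> 1"
  shows "dist_of_fun (\<lambda>x. exp (bilin x z)) \<in> gs_dual t s"
proof -
  let ?u = "dist_of_fun (\<lambda>x. exp (bilin x z))"
  note int = gelfand_shilov_integrable_exp_bilin[OF _ t, of _ s z]
  have add: "?u (\<lambda>x. \<phi> x + \<eta> x) = ?u \<phi> + ?u \<eta>"
    if "\<phi> \<in> gelfand_shilov t s" "\<eta> \<in> gelfand_shilov t s" for \<phi> \<eta>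
    using int[OF that(1)] int[OF that(2)] by (simp add: dist_of_fun_def distrib_left)
  have scale: "?u (\<lambda>x. c * \<phi> x) = cnj c * ?u \<phi>" for \<phi> c
    unfolding dist_of_fun_def by (simp add: mult.left_commute)
  have top: "topspace (gs_topology t s) \<subseteq> gelfand_shilov t s"
    by (auto simp: gs_topology_def)
  obtain h where h: "0 < h" "(norm (re_vec z) + 1) * (2 * h * real CARD('n)) \<le> 1"
    by (rule ex_small_h)
  define I where "I = (LINT x :: real ^ 'n|lborel. exp (- norm x))"
  have I: "0 \<le> I" by (simp add: I_def)
  have "openin (gs_topology t s) {f \<in> topspace (gs_topology t s). ?u f \<in> W}" if "open W" for W
    unfolding openin_subopen[of _ "{f \<in> topspace (gs_topology t s). ?u f \<in> W}"]
  proof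
    fix f assume "f \<in> {f \<in> topspace (gs_topology t s). ?u f \<in> W}"
    then have f: "f \<in> gelfand_shilov t s" "?u f \<in> W" using top by auto
    obtain e where e: "0 < e" "ball (?u f) e \<subseteq> W" using \<open>open W\<close> f(2) by (rule openE)
    \<comment> \<open>Makes \<open>2 * \<epsilon> * I\<close>, the bound on the change of the
      functional, smaller than \<open>e\<close>.\<close>
    define \<epsilon> where "\<epsilon> = e / (2 * I + 1)"
    have \<epsilon>: "0 < \<epsilon>" "2 * \<epsilon> * I < e" using e I by (auto simp: \<epsilon>_def field_simps add_nonneg_pos)
    let ?T = "{g \<in> gelfand_shilov t s. gs_norm t s h (\<lambda>x. g x - f x) < ennreal \<epsilon>}"
    have T: "openin (gs_topology t s) ?T"
      unfolding gs_topology_def using f h \<epsilon> by (intro topology_generated_by_Basis) blast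
    moreover have "f \<in> ?T" using f \<epsilon> by (simp add: gs_norm_zero)
    moreover have "?T \<subseteq> {f \<in> topspace (gs_topology t s). ?u f \<in> W}"
    proof
      fix g assume g: "g \<in> ?T"
      then have g_top: "g \<in> topspace (gs_topology t s)" using T openin_subset by blast
      have gf: "g \<in> gelfand_shilov t s" "gs_norm t s h (\<lambda>x. g x - f x) \<le> ennreal \<epsilon>"
        using g by auto
      have meas: "g \<in> borel_measurable borel" "f \<in> borel_measurable borel"
        using smooth_iterated_partial_deriv_measurable[where n = 0] f gf by (auto simp: gelfand_shilov_def)
      have "?u g - ?u f = ?u (\<lambda>x. g x - f x)"
        using int[OF gf(1)] int[OF f(1)] by (simp add: dist_of_fun_def right_diff_distrib)
      also have "cmod \<dots> \<le> 2 * \<epsilon> * I"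
        using dist_of_fun_exp_bilin_le[OF h less_imp_le[OF \<epsilon>(1)] gf(2) t, where n = 0] meas
        by (simp add: I_def)
      finally have "?u g \<in> ball (?u f) e" using \<epsilon>(2) by (simp add: dist_norm norm_minus_commute)
      then show "g \<in> {f \<in> topspace (gs_topology t s). ?u f \<in> W}" using g_top e by auto
    qed
    ultimately show "\<exists>T. openin (gs_topology t s) T \<and> f \<in> T \<and>
      T \<subseteq> {f \<in> topspace (gs_topology t s). ?u f \<in> W}" by blast
  qed
  then show ?thesis
    using add scale by (simp add: gs_dual_def continuous_map_def)
qed

section \<open>The two inclusions for the wave front set\<close>

lemma exp_bilin_notin_wave_front:
  fixes \<psi> :: "real ^ 'n::finite \<Rightarrow> complex" and z :: "complex ^ 'n"
  assumes t: "0 < t" "t \<le> 1" and s: "0 < s" and \<psi>: "\<psi> \<in> gelfand_shilov t s" and "\<xi>0 \<noteq> 0"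
  shows "(x0, \<xi>0) \<notin> wave_front t s \<psi> (dist_of_fun (\<lambda>x. exp (bilin x z)))"
proof -
  let ?u = "\<lambda>w. dist_of_fun (\<lambda>x. exp (bilin x w)) \<psi>"
  let ?c = "(2 * pi) powr (- real CARD('n) / 2)"
  obtain j where j: "\<xi>0 $ j \<noteq> 0" using \<open>\<xi>0 \<noteq> 0\<close> by (auto simp: vec_eq_iff)
  define c where "c = \<bar>\<xi>0 $ j\<bar> / 2"
  define R where "R = norm x0 + 1"
  define B where "B = R * norm (re_vec z)"
  define p where "p = 1 / s"
  have c: "0 < c" using j by (simp add: c_def)
  have B: "0 \<le> B" by (simp add: B_def R_def add_nonneg_nonneg)
  have p: "0 < p" "s * p = 1" using s by (auto simp: p_def)
  \<comment> \<open>Bounding \<open>x\<close> limits the growth of the exponential, while keeping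
    one frequency coordinate away from 0 both excludes the origin and yields decay.\<close>
  define U where "U = {q :: (real ^ 'n) \<times> (real ^ 'n). norm (fst q) < R \<and> c < \<bar>snd q $ j\<bar>}"
  have "open U"
    unfolding U_def by (intro open_Collect_conj open_Collect_less continuous_intros)
  moreover have "U \<subseteq> - {0}" using c by (auto simp: U_def)
  moreover have "(x0, \<xi>0) \<in> U" using c by (simp add: U_def R_def c_def)
  moreover have "(SUP (l, x, \<xi>) \<in> {0<..} \<times> U.
      ennreal (exp (r * l) * cmod (stft \<psi> (dist_of_fun (\<lambda>x. exp (bilin x z))) ((l powr t) *\<^sub>R x) ((l powr s) *\<^sub>R \<xi>)))) < \<infinity>"
    if r: "0 < r" for r
  proof -
    \<comment> \<open>The rate that lets the decay in \<open>w $ j\<close> outweigh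
      \<open>(r + B) * l\<close>, obtained by solving
      \<open>l powr s * c \<le> cmod (z $ j) + cmod (w $ j)\<close> for \<open>l\<close>.\<close>
    define Q where "Q = (r + B) * (2 powr p / c powr p)"
    have Q: "0 < Q" using r B c by (simp add: Q_def add_pos_nonneg)
    obtain K where K: "0 \<le> K" "\<And>w. re_vec w = re_vec z \<Longrightarrow>
        exp (Q * cmod (w $ j) powr (1 / s)) * cmod (?u w) \<le> K"
      using dist_of_fun_exp_bilin_decay[OF \<psi> t(2) s Q, of "re_vec z" j] by blast
    define E where "E = exp (B + Q * cmod (z $ j) powr p)"
    have "exp (r * l) * cmod (stft \<psi> (dist_of_fun (\<lambda>x. exp (bilin x z))) ((l powr t) *\<^sub>R x) ((l powr s) *\<^sub>R \<xi>))
        \<le> ?c * (E * K)" if l: "0 < l" and U: "(x, \<xi>) \<in> U" for l x \<xi>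
    proof -
      define w where "w = twist z ((l powr s) *\<^sub>R \<xi>)"
      \<comment> \<open>The supremum runs over all positive \<open>l\<close>, so small values are
        covered by the summand 1.\<close>
      have lt: "l powr t \<le> 1 + l"
      proof (cases "l \<le> 1")
        case True
        then show ?thesis using powr_mono2[of t l 1] l t by simp
      next
        case False
        then show ?thesis using powr_mono[of t 1 l] t by simp
      qed
      have "x \<bullet> re_vec z \<le> norm x * norm (re_vec z)" by (rule norm_cauchy_schwarz)
      also have "\<dots> \<le> B" unfolding B_def using U by (intro mult_right_mono) (auto simp: U_def)
      finally have "l powr t * (x \<bullet> re_vec z) \<le> l powr t * B" by (intro mult_left_mono) auto
      also have "\<dots> \<le> (1 + l) * B" using lt B by (intro mult_right_mono)
      finally have 1: "r * l + l powr t * (x \<bullet> re_vec z) \<le> B + (r + B) * l" by (simp add: algebra_simps)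
      have "l powr s * c \<le> l powr s * \<bar>\<xi> $ j\<bar>" using U by (intro mult_left_mono) (auto simp: U_def)
      also have "\<dots> = cmod (z $ j - w $ j)"
        by (simp add: w_def twist_def norm_mult abs_mult)
      also have "\<dots> \<le> cmod (z $ j) + cmod (w $ j)" by (rule norm_triangle_ineq4)
      \<comment> \<open>Passing to the maximum bounds the power of the sum for every positive
        exponent \<open>p\<close>, whether below or above 1.\<close>
      also have "\<dots> \<le> 2 * max (cmod (z $ j)) (cmod (w $ j))" by simp
      finally have "(l powr s * c) powr p \<le> (2 * max (cmod (z $ j)) (cmod (w $ j))) powr p"
        using p c by (intro powr_mono2) auto
      also have "\<dots> = 2 powr p * max (cmod (z $ j)) (cmod (w $ j)) powr p"
        by (simp add: powr_mult)
      also have "\<dots> \<le> 2 powr p * (cmod (z $ j) powr p + cmod (w $ j) powr p)"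
        by (intro mult_left_mono) (auto simp: max_def)
      also have "(l powr s * c) powr p = l * c powr p"
        using l c p by (simp add: powr_mult powr_powr)
      finally have "l \<le> 2 powr p / c powr p * (cmod (z $ j) powr p + cmod (w $ j) powr p)"
        using c by (simp add: field_simps)
      then have "(r + B) * l \<le> (r + B) * (2 powr p / c powr p * (cmod (z $ j) powr p + cmod (w $ j) powr p))"
        using r B by (intro mult_left_mono) auto
      also have "\<dots> = Q * cmod (z $ j) powr p + Q * cmod (w $ j) powr p"
        unfolding Q_def by (simp only: distrib_left mult.assoc)
      finally have "r * l + l powr t * (x \<bullet> re_vec z) \<le> (B + Q * cmod (z $ j) powr p) + Q * cmod (w $ j) powr p"
        using 1 by linarith
      then have "exp (r * l + l powr t * (x \<bullet> re_vec z)) \<le> E * exp (Q * cmod (w $ j) powr p)"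
        unfolding E_def exp_add[symmetric] by simp
      then have "exp (r * l + l powr t * (x \<bullet> re_vec z)) * cmod (?u w) \<le> E * exp (Q * cmod (w $ j) powr p) * cmod (?u w)"
        by (intro mult_right_mono) auto
      also have "\<dots> \<le> E * K"
        using mult_left_mono[OF K(2)[of w], of E] by (simp add: w_def p_def E_def mult.assoc)
      finally have "?c * (exp (r * l + l powr t * (x \<bullet> re_vec z)) * cmod (?u w)) \<le> ?c * (E * K)"
        by (intro mult_left_mono) auto
      then show ?thesis
        unfolding cmod_stft_exp_bilin[OF \<psi> t(2)] by (simp add: exp_add w_def mult_ac)
    qed
    then have "(SUP (l, x, \<xi>) \<in> {0<..} \<times> U.
      ennreal (exp (r * l) * cmod (stft \<psi> (dist_of_fun (\<lambda>x. exp (bilin x z))) ((l powr t) *\<^sub>R x) ((l powr s) *\<^sub>R \<xi>))))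
        \<le> ennreal (?c * (E * K))"
      by (intro SUP_least) (auto intro!: ennreal_leI)
    then show ?thesis using ennreal_less_top[of "?c * (E * K)"] by (auto intro: le_less_trans)
  qed
  ultimately show ?thesis unfolding wave_front_def by blast
qed

text \<open>With a frequency \<open>\<eta>\<close> at which the transform is nonzero, the points
  \<open>(x0, l powr (- s) *\<^sub>R \<eta>)\<close> eventually enter every neighbourhood of
  \<open>(x0, 0)\<close>, and the dilation by \<open>l powr s\<close> brings their frequency back to
  \<open>\<eta>\<close>.\<close>

lemma exp_bilin_in_wave_front:
  fixes \<psi> :: "real ^ 'n::finite \<Rightarrow> complex" and z :: "complex ^ 'n"
  assumes t: "t \<le> 1" and s: "0 < s" and \<psi>: "\<psi> \<in> gelfand_shilov t s" "\<psi> \<noteq> (\<lambda>x. 0)" and "x0 \<noteq> 0"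
  shows "(x0, 0) \<in> wave_front t s \<psi> (dist_of_fun (\<lambda>x. exp (bilin x z)))"
proof -
  let ?u = "\<lambda>w. dist_of_fun (\<lambda>x. exp (bilin x w)) \<psi>"
  let ?c = "(2 * pi) powr (- real CARD('n) / 2)"
  let ?V = "\<lambda>l x \<xi>. cmod (stft \<psi> (dist_of_fun (\<lambda>x. exp (bilin x z))) ((l powr t) *\<^sub>R x) ((l powr s) *\<^sub>R \<xi>))"
  have False if U: "open U" "(x0, 0) \<in> U" and
    fin: "\<And>r. 0 < r \<Longrightarrow> (SUP (l, x, \<xi>) \<in> {0<..} \<times> U. ennreal (exp (r * l) * ?V l x \<xi>)) < \<infinity>" for U
  proof -
    obtain \<eta> where \<eta>: "?u (twist z \<eta>) \<noteq> 0"
      by (rule ex_dist_of_fun_exp_bilin_twist_neq_0[OF \<psi> t])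
    define B where "B = norm x0 * norm (re_vec z)"
    define a where "a = ?c * cmod (?u (twist z \<eta>))"
    have a: "0 < a" using \<eta> by (simp add: a_def)
    have B: "0 \<le> B" by (simp add: B_def)
    \<comment> \<open>Along the chosen points the transform decays at rate at most \<open>B\<close>
      for \<open>l \<ge> 1\<close>; the rate \<open>B + 1\<close> leaves a factor
      \<open>exp l\<close>, which is unbounded.\<close>
    have "(SUP (l, x, \<xi>) \<in> {0<..} \<times> U. ennreal (exp ((B + 1) * l) * ?V l x \<xi>)) < \<infinity>"
      using fin B by simp
    then obtain S where S: "0 \<le> S"
      "(SUP (l, x, \<xi>) \<in> {0<..} \<times> U. ennreal (exp ((B + 1) * l) * ?V l x \<xi>)) = ennreal S"
      by (cases "SUP (l, x, \<xi>) \<in> {0<..} \<times> U. ennreal (exp ((B + 1) * l) * ?V l x \<xi>)") auto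
    have "((\<lambda>l. l powr (- s)) \<longlongrightarrow> 0) at_top" using s by (intro tendsto_neg_powr filterlim_ident) auto
    then have "((\<lambda>l. (x0, (l powr (- s)) *\<^sub>R \<eta>)) \<longlongrightarrow> (x0, 0 *\<^sub>R \<eta>)) at_top"
      by (intro tendsto_intros)
    then have "\<forall>\<^sub>F l in at_top. (x0, (l powr (- s)) *\<^sub>R \<eta>) \<in> U"
      using U by (intro topological_tendstoD) auto
    moreover have "\<forall>\<^sub>F l :: real in at_top. 1 \<le> l" by (rule eventually_ge_at_top)
    moreover have "\<forall>\<^sub>F l :: real in at_top. S / a < exp l"
      using exp_at_top by (auto simp: filterlim_at_top_dense)
    ultimately have "\<forall>\<^sub>F l :: real in at_top. False"
    proof eventually_elim
      case (elim l)
      have l: "0 < l" using elim by simp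
      have "ennreal (exp ((B + 1) * l) * ?V l x0 ((l powr (- s)) *\<^sub>R \<eta>)) \<le> ennreal S"
        unfolding S(2)[symmetric]
        using SUP_upper[of "(l, x0, (l powr (- s)) *\<^sub>R \<eta>)" "{0<..} \<times> U"
            "\<lambda>(l, x, \<xi>). ennreal (exp ((B + 1) * l) * ?V l x \<xi>)"] elim l by simp
      then have "exp ((B + 1) * l) * ?V l x0 ((l powr (- s)) *\<^sub>R \<eta>) \<le> S"
        using S(1) by (simp only: ennreal_le_iff)
      also have "(l powr s) *\<^sub>R (l powr (- s)) *\<^sub>R \<eta> = \<eta>"
        using l by (simp add: powr_add[symmetric])
      then have "?V l x0 ((l powr (- s)) *\<^sub>R \<eta>) = a * exp (l powr t * (x0 \<bullet> re_vec z))"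
        unfolding cmod_stft_exp_bilin[OF \<psi>(1) t] by (simp add: a_def)
      finally have le: "exp ((B + 1) * l) * (a * exp (l powr t * (x0 \<bullet> re_vec z))) \<le> S" .
      have "- (x0 \<bullet> re_vec z) \<le> B"
        unfolding B_def using Cauchy_Schwarz_ineq2[of x0 "re_vec z"] by linarith
      then have "l powr t * - (x0 \<bullet> re_vec z) \<le> l powr t * B" by (intro mult_left_mono) auto
      also have "\<dots> \<le> l * B" using powr_mono[OF t, of l] elim B by (intro mult_right_mono) auto
      finally have "l \<le> (B + 1) * l + l powr t * (x0 \<bullet> re_vec z)" by (simp add: algebra_simps)
      then have "a * exp l \<le> a * exp ((B + 1) * l + l powr t * (x0 \<bullet> re_vec z))" using a by simp
      also have "\<dots> \<le> S" using le by (simp add: exp_add mult_ac)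
      finally have "exp l \<le> S / a" using a by (simp add: field_simps)
      then show False using elim by simp
    qed
    then show False by simp
  qed
  then show ?thesis using \<open>x0 \<noteq> 0\<close> unfolding wave_front_def by (auto simp: prod_eq_iff)
qed

theorem proposition8p1:
  fixes t s :: real and z :: "complex ^ 'n::finite" and \<psi> :: "real ^ 'n \<Rightarrow> complex"
  assumes "0 < t" and "t \<le> 1" and "0 < s" and "s + t > 1"
    and "\<psi> \<in> gelfand_shilov t s" and "\<psi> \<noteq> (\<lambda>x. 0)"
  shows "dist_of_fun (\<lambda>x. exp (bilin x z)) \<in> gs_dual t s \<and>
    wave_front t s \<psi> (dist_of_fun (\<lambda>x. exp (bilin x z))) = (UNIV - {0}) \<times> {0}"
proof
  show "dist_of_fun (\<lambda>x. exp (bilin x z)) \<in> gs_dual t s"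
    by (rule dist_of_fun_exp_bilin_in_gs_dual) fact
  \<comment> \<open>The origin, excluded by definition, is the only point that the two preceding
    lemmas leave open.\<close>
  have "(0, 0) \<notin> wave_front t s \<psi> (dist_of_fun (\<lambda>x. exp (bilin x z)))"
    by (simp add: wave_front_def zero_prod_def)
  then have "p \<in> wave_front t s \<psi> (dist_of_fun (\<lambda>x. exp (bilin x z))) \<longleftrightarrow> p \<in> (UNIV - {0}) \<times> {0}" for p
    using exp_bilin_notin_wave_front[OF assms(1-3,5), of "snd p" "fst p" z]
      exp_bilin_in_wave_front[OF assms(2,3,5,6), of "fst p" z]
    by (cases p) auto
  then show "wave_front t s \<psi> (dist_of_fun (\<lambda>x. exp (bilin x z))) = (UNIV - {0}) \<times> {0}" by blast
qed

end
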